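(* Let $t_0\in\mathbb{R}$ and let $r>0$ be finite and fixed. Let $A(t)=\sum_{n=0}^\infty A_n(t-t_0)^n$ and $B(t)=\sum_{n=0}^\infty B_n(t-t_0)^n$ be two random power series in the $\mathrm{L}^\infty(\Omega)$ setting, for $t\in(t_0-r,t_0+r)$, and let $Y_0,Y_1\in\mathrm{L}^2(\Omega)$. Suppose that $Y_0$ is absolutely continuous with density function $f_{Y_0}$ and is independent of $(Y_1,A_0,A_1,\ldots,B_0,B_1,\ldots)$. If $f_{Y_0}$ is almost everywhere continuous on $\mathbb{R}$, $f_{Y_0}(y)\le\alpha+\beta y^2$ for all $y\in\mathbb{R}$ for certain constants $\alpha,\beta\ge0$, $Y_1$ is absolutely continuous, and $Y_1$ is independent of $(A,B)$ (that is, of $(A_0,A_1,\ldots,B_0,B_1,\ldots)$), then $$\lim_{N\to\infty}f_{X^N(t)}(x)=f_{X(t)}(x)$$ for each $t\in(t_0-\min\{\delta,\mu\},t_0+\min\{\delta,\mu\})\setminus\{t_0\}$ and for every $x\in\mathbb{R}$.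
   Context: $(\Omega,\mathcal{F},\mathbb{P})$ is a complete probability space; $\mathrm{L}^p(\Omega)$ is the Lebesgue space of real random variables with norm $\|\cdot\|_p$. A random power series $\sum_n A_n(t-t_0)^n$ is "in the $\mathrm{L}^\infty(\Omega)$ setting for $t\in(t_0-r,t_0+r)$" if $A_n\in\mathrm{L}^\infty(\Omega)$ for all $n$ and for every such $t$ the series converges in $\mathrm{L}^\infty(\Omega)$. "Almost everywhere continuous" means that the set of discontinuity points has Lebesgue measure zero. $S_0(t)=\sum_{n\ge0}S_{0,n}(t-t_0)^n$ and $S_1(t)=\sum_{n\ge0}S_{1,n}(t-t_0)^n$ are the random power series, convergent in $\mathrm{L}^\infty(\Omega)$ for $t\in(t_0-r,t_0+r)$, with $S_{0,0}=1$, $S_{0,1}=0$, $S_{1,0}=0$, $S_{1,1}=1$ and, for $i\in\{0,1\}$ and $n\ge0$, $S_{i,n+2}=\frac{-1}{(n+2)(n+1)}\sum_{m=0}^n[(m+1)A_{n-m}S_{i,m+1}+B_{n-m}S_{i,m}]$. The process $X(t)=Y_0S_0(t)+Y_1S_1(t)$ is the mean square solution of $\ddot X+A\dot X+BX=0$, $X(t_0)=Y_0$, $\dot X(t_0)=Y_1$. $S_i^N(t)=\sum_{n=0}^NS_{i,n}(t-t_0)^n$ are the partial sums, and $X^N(t)=Y_0S_0^N(t)+Y_1S_1^N(t)$. $\delta\in(0,r]$ is a number such that $\|S_0(t)-1\|_\infty<1/4$ for all $t\in(t_0-\delta,t_0+\delta)$ (it exists since $S_0(t_0)=1$ and $S_0$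 is continuous in $\mathrm{L}^\infty(\Omega)$); hence $S_0(t)>3/4$ almost surely there. For $t\in(t_0-\delta,t_0+\delta)$, $N_t$ is a positive integer such that $\|S_0^N(t)-S_0(t)\|_\infty<1/4$ for all $N\ge N_t$, so that $S_0^N(t)>1/2$ almost surely for $N\ge N_t$. $\mu\in(0,r]$ is a number such that $\dot S_1(t)>3/4$ almost surely for each $t\in(t_0-\mu,t_0+\mu)$, where $\dot S_1$ is the $\mathrm{L}^\infty(\Omega)$ derivative (it exists since $\dot S_1(t_0)=1$); hence $|S_1(t)|>\frac34|t-t_0|$ almost surely for $t\in(t_0-\mu,t_0+\mu)\setminus\{t_0\}$. The densities of $X(t)$ and of $X^N(t)$ ($N\ge N_t$) are the functions $$f_{X(t)}(x)=\mathbb{E}\left[f_{Y_0}\left(\tfrac{x-Y_1S_1(t)}{S_0(t)}\right)\tfrac{1}{|S_0(t)|}\right],\qquad f_{X^N(t)}(x)=\mathbb{E}\left[f_{Y_0}\left(\tfrac{x-Y_1S_1^N(t)}{S_0^N(t)}\right)\tfrac{1}{|S_0^N(t)|}\right].$$ *)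

theory Defs
  imports "HOL-Probability.Probability"
begin

text \<open>
  Random variables are functions on the sample space; the norm of \<open>L\<^sup>\<infinity>(\<Omega>)\<close> is the
  essential supremum of the absolute value, as an extended real.  Elements of
  \<open>L\<^sup>\<infinity>(\<Omega>)\<close> are represented by functions, so limits are unique only up to
  almost sure equality.
\<close>

definition Linf_norm :: "'a measure \<Rightarrow> ('a \<Rightarrow> real) \<Rightarrow> ereal" where
  "Linf_norm M f = esssup M (\<lambda>\<omega>. ereal \<bar>f \<omega>\<bar>)"

definition Linf_space :: "'a measure \<Rightarrow> ('a \<Rightarrow> real) set" where
  "Linf_space M = {f \<in> borel_measurable M. Linf_norm M f < \<infinity>}"

definition L2_space :: "'a measure \<Rightarrow> ('a \<Rightarrow> real) set" where
  "L2_space M = {f \<in> borel_measurable M. integrable M (\<lambda>\<omega>. (f \<omega>)\<^sup>2)}"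

definition Linf_tendsto ::
    "'a measure \<Rightarrow> ('i \<Rightarrow> 'a \<Rightarrow> real) \<Rightarrow> ('a \<Rightarrow> real) \<Rightarrow> 'i filter \<Rightarrow> bool" where
  "Linf_tendsto M F f G \<longleftrightarrow>
     f \<in> Linf_space M \<and> ((\<lambda>i. Linf_norm M (\<lambda>\<omega>. F i \<omega> - f \<omega>)) \<longlongrightarrow> 0) G"

definition partial_sum ::
    "real \<Rightarrow> (nat \<Rightarrow> 'a \<Rightarrow> real) \<Rightarrow> nat \<Rightarrow> real \<Rightarrow> 'a \<Rightarrow> real" where
  "partial_sum t0 C N t \<omega> = (\<Sum>n\<le>N. C n \<omega> * (t - t0) ^ n)"

definition random_power_series_on ::
    "'a measure \<Rightarrow> real \<Rightarrow> real \<Rightarrow> (nat \<Rightarrow> 'a \<Rightarrow> real) \<Rightarrow> bool" where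
  "random_power_series_on M t0 r C \<longleftrightarrow>
     (\<forall>n. C n \<in> Linf_space M) \<and>
     (\<forall>t\<in>{t0 - r<..<t0 + r}. \<exists>f. Linf_tendsto M (\<lambda>N. partial_sum t0 C N t) f sequentially)"

text \<open>
  The sum of a series and the derivative of a process are a chosen representative of the limit in
  \<open>L\<^sup>\<infinity>(\<Omega>)\<close> (and unspecified where there is no limit).
\<close>

definition Linf_series_sum ::
    "'a measure \<Rightarrow> real \<Rightarrow> (nat \<Rightarrow> 'a \<Rightarrow> real) \<Rightarrow> real \<Rightarrow> 'a \<Rightarrow> real" where
  "Linf_series_sum M t0 C t =
     (SOME f. Linf_tendsto M (\<lambda>N. partial_sum t0 C N t) f sequentially)"

definition Linf_deriv :: "'a measure \<Rightarrow> (real \<Rightarrow> 'a \<Rightarrow> real) \<Rightarrow> real \<Rightarrow> 'a \<Rightarrow> real" where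
  "Linf_deriv M Z t = (SOME D. Linf_tendsto M (\<lambda>h \<omega>. (Z (t + h) \<omega> - Z t \<omega>) / h) D (at 0))"

text \<open>
  Coefficients of the power series solution of \<open>S'' + A S' + B S = 0\<close> with
  \<open>S(t\<^sub>0) = c0\<close>, \<open>S'(t\<^sub>0) = c1\<close>.
\<close>

fun sol_coeff ::
    "(nat \<Rightarrow> 'a \<Rightarrow> real) \<Rightarrow> (nat \<Rightarrow> 'a \<Rightarrow> real) \<Rightarrow> real \<Rightarrow> real \<Rightarrow> nat \<Rightarrow> 'a \<Rightarrow> real" where
  "sol_coeff A B c0 c1 0 \<omega> = c0"
| "sol_coeff A B c0 c1 (Suc 0) \<omega> = c1"
| "sol_coeff A B c0 c1 (Suc (Suc n)) \<omega> =
     - 1 / ((real n + 2) * (real n + 1)) *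
       (\<Sum>m\<in>{0..n}. (real m + 1) * A (n - m) \<omega> * sol_coeff A B c0 c1 (Suc m) \<omega>
                   + B (n - m) \<omega> * sol_coeff A B c0 c1 m \<omega>)"

abbreviation S0_coeff :: "(nat \<Rightarrow> 'a \<Rightarrow> real) \<Rightarrow> (nat \<Rightarrow> 'a \<Rightarrow> real) \<Rightarrow> nat \<Rightarrow> 'a \<Rightarrow> real" where
  "S0_coeff A B \<equiv> sol_coeff A B 1 0"

abbreviation S1_coeff :: "(nat \<Rightarrow> 'a \<Rightarrow> real) \<Rightarrow> (nat \<Rightarrow> 'a \<Rightarrow> real) \<Rightarrow> nat \<Rightarrow> 'a \<Rightarrow> real" where
  "S1_coeff A B \<equiv> sol_coeff A B 0 1"

text \<open>
  The density of \<open>Y\<^sub>0 s\<^sub>0 + Y\<^sub>1 s\<^sub>1\<close>, where \<open>Y\<^sub>0\<close> has density \<open>f\<close>.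
\<close>

definition comb_density ::
    "'a measure \<Rightarrow> (real \<Rightarrow> real) \<Rightarrow> ('a \<Rightarrow> real) \<Rightarrow> ('a \<Rightarrow> real) \<Rightarrow> ('a \<Rightarrow> real) \<Rightarrow> real \<Rightarrow> real" where
  "comb_density M f Y1 s0 s1 x =
     (LINT \<omega>|M. f ((x - Y1 \<omega> * s1 \<omega>) / s0 \<omega>) * (1 / \<bar>s0 \<omega>\<bar>))"

definition density_X ::
    "'a measure \<Rightarrow> (real \<Rightarrow> real) \<Rightarrow> ('a \<Rightarrow> real) \<Rightarrow> real \<Rightarrow> (nat \<Rightarrow> 'a \<Rightarrow> real) \<Rightarrow> (nat \<Rightarrow> 'a \<Rightarrow> real)
      \<Rightarrow> real \<Rightarrow> real \<Rightarrow> real" where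
  "density_X M f Y1 t0 A B t x =
     comb_density M f Y1 (Linf_series_sum M t0 (S0_coeff A B) t)
       (Linf_series_sum M t0 (S1_coeff A B) t) x"

text \<open>For small \<open>N\<close> the partial sum of \<open>S\<^sub>0\<close> need not be bounded away from \<open>0\<close>, and the following
  is a density only for all sufficiently large \<open>N\<close>.\<close>

definition density_XN ::
    "'a measure \<Rightarrow> (real \<Rightarrow> real) \<Rightarrow> ('a \<Rightarrow> real) \<Rightarrow> real \<Rightarrow> (nat \<Rightarrow> 'a \<Rightarrow> real) \<Rightarrow> (nat \<Rightarrow> 'a \<Rightarrow> real)
      \<Rightarrow> nat \<Rightarrow> real \<Rightarrow> real \<Rightarrow> real" where
  "density_XN M f Y1 t0 A B N t x =
     comb_density M f Y1 (partial_sum t0 (S0_coeff A B) N t)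
       (partial_sum t0 (S1_coeff A B) N t) x"

text \<open>
  Independence of two random variables with possibly different value types; the library's
  \<open>indep_var\<close> requires equal types (cf. \<open>prob_space.indep_var_eq\<close>).
\<close>

definition indep_rv ::
    "'a measure \<Rightarrow> 'b measure \<Rightarrow> ('a \<Rightarrow> 'b) \<Rightarrow> 'c measure \<Rightarrow> ('a \<Rightarrow> 'c) \<Rightarrow> bool" where
  "indep_rv M N X N' Y \<longleftrightarrow>
     X \<in> measurable M N \<and> Y \<in> measurable M N' \<and>
     prob_space.indep_set M {X -` S \<inter> space M | S. S \<in> sets N} {Y -` S \<inter> space M | S. S \<in> sets N'}"

definition seq_borel :: "(nat \<Rightarrow> real) measure" where
  "seq_borel = (\<Pi>\<^sub>M n\<in>UNIV. borel)"

end

theory Submission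
  imports Defs
begin

text \<open>
  The densities are expectations of \<open>f ((x - Y1 s1) / s0) / \<bar>s0\<bar>\<close>, where \<open>f\<close> is the density of
  \<open>Y0\<close> and \<open>s0\<close>, \<open>s1\<close> are \<open>S0(t)\<close>, \<open>S1(t)\<close> or their partial sums, so the claim is an interchange
  of limit and expectation, obtained by dominated convergence (\<open>comb_density_tendsto\<close>).

  Domination comes from the growth bound: \<open>S0\<close> is within \<open>1/4\<close> of \<open>1\<close>, so its late partial sums
  are at least \<open>1/2\<close>, and the partial sums of \<open>S1\<close> are bounded by a constant.  Hence the integrand is
  at most a constant plus a multiple of \<open>Y1\<^sup>2\<close>, which is integrable.

  Pointwise convergence needs \<open>f\<close> to be continuous at \<open>(x - Y1 S1(t)) / S0(t)\<close> almost surely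
  (\<open>AE_isCont_affine_quotient\<close>).  Since \<open>Y1\<close> is independent of \<open>(A, B)\<close>, on which \<open>S0(t)\<close> and
  \<open>S1(t)\<close> depend, these two values may be fixed by Fubini's theorem.  If \<open>S1(t) \<noteq> 0\<close>, the quotient
  is then a nonconstant affine function of \<open>Y1\<close>, whose law has a density, and so it almost surely avoids
  the null set of discontinuities of \<open>f\<close>.

  That \<open>S1(t) \<noteq> 0\<close> almost surely for \<open>t \<noteq> t0\<close> near \<open>t0\<close> is a mean value argument on single paths
  (\<open>pathwise_sum_abs_ge\<close>): the derivative exceeds \<open>3/4\<close> almost surely at each such time, hence
  almost surely at all rational distances from \<open>t0\<close> at once, and the path derivative is continuous.

  Both parts need limits in \<open>L\<^sup>\<infinity>(\<Omega>)\<close> to be computed path by path.  Here the key is a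
  deterministic majorant (\<open>sol_coeff_dominated\<close>): almost surely all coefficients \<open>A\<^sub>n\<close>, \<open>B\<^sub>n\<close> are
  bounded by a geometric sequence \<open>C / \<rho>\<^sup>n\<close>, so the coefficients of the solution are bounded by those
  of the equation with coefficients \<open>-C / \<rho>\<^sup>n\<close> and the same initial values, and these make up a power series that converges
  absolutely inside the radius \<open>\<rho>\<close>.  Sums and derivatives in \<open>L\<^sup>\<infinity>(\<Omega>)\<close> then agree almost
  surely with the ordinary ones.
\<close>

section \<open>Norms and limits in \<open>L\<^sup>\<infinity>(\<Omega>)\<close>\<close>

text \<open>
  The essential supremum over a null space is \<open>- \<infinity>\<close>; a probability measure excludes this, and the
  norm can be squeezed between \<open>0\<close> and an upper bound.
\<close>

lemma Linf_norm_nonneg: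
  assumes "prob_space M"
  shows "0 \<le> Linf_norm M f"
proof -
  interpret prob_space M by fact
  have "0 = esssup M (\<lambda>_. 0 :: ereal)"
    by (rule esssup_const[symmetric]) (simp add: emeasure_space_1)
  also have "\<dots> \<le> Linf_norm M f"
    unfolding Linf_norm_def by (rule esssup_mono) auto
  finally show ?thesis .
qed

lemma AE_abs_le_Linf_norm:
  assumes "Linf_norm M f \<le> ereal c"
  shows "AE \<omega> in M. \<bar>f \<omega>\<bar> \<le> c"
  using esssup_AE[of "\<lambda>\<omega>. ereal \<bar>f \<omega>\<bar>" M]
proof eventually_elim
  case (elim \<omega>)
  then have "ereal \<bar>f \<omega>\<bar> \<le> ereal c"
    using assms unfolding Linf_norm_def by (rule order_trans)
  then show ?case by simp
qed

lemma Linf_norm_le: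
  assumes "f \<in> borel_measurable M" "AE \<omega> in M. \<bar>f \<omega>\<bar> \<le> c"
  shows "Linf_norm M f \<le> ereal c"
  unfolding Linf_norm_def using assms by (intro esssup_I) auto

lemma Linf_space_AE_bound:
  assumes "f \<in> Linf_space M"
  obtains c where "AE \<omega> in M. \<bar>f \<omega>\<bar> \<le> c"
proof (cases "Linf_norm M f")
  case (real x)
  then show ?thesis using that AE_abs_le_Linf_norm[of M f x] by auto
next
  case PInf
  then show ?thesis using assms by (simp add: Linf_space_def)
next
  case MInf
  then have "AE \<omega> in M. \<bar>f \<omega>\<bar> \<le> 0" by (intro AE_abs_le_Linf_norm) simp
  then show ?thesis by (rule that)
qed

lemma Linf_tendsto_eventually_AE:
  assumes "Linf_tendsto M F f G" "0 < e"
  shows "eventually (\<lambda>i. AE \<omega> in M. \<bar>F i \<omega> - f \<omega>\<bar> \<le> e) G"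
proof -
  have "((\<lambda>i. Linf_norm M (\<lambda>\<omega>. F i \<omega> - f \<omega>)) \<longlongrightarrow> 0) G"
    using assms by (simp add: Linf_tendsto_def)
  then have "eventually (\<lambda>i. Linf_norm M (\<lambda>\<omega>. F i \<omega> - f \<omega>) < ereal e) G"
    using assms(2) by (auto simp: order_tendsto_iff)
  then show ?thesis
    by eventually_elim (auto intro: AE_abs_le_Linf_norm)
qed

text \<open>
  Measurability of \<open>F i\<close> is only asked for eventually, because the difference quotients of a series sum
  involve unspecified functions when the increment leaves the interval of convergence.
\<close>

lemma Linf_tendstoI:
  assumes "prob_space M"
    and f: "f \<in> borel_measurable M" "AE \<omega> in M. \<bar>f \<omega>\<bar> \<le> c"
    and le: "eventually (\<lambda>i. F i \<in> borel_measurable M \<and> (AE \<omega> in M. \<bar>F i \<omega> - f \<omega>\<bar> \<le> e i)) G"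
    and e: "(e \<longlongrightarrow> 0) G"
  shows "Linf_tendsto M F f G"
proof -
  have "Linf_norm M f \<le> ereal c"
    using f by (rule Linf_norm_le)
  then have "f \<in> Linf_space M"
    using f(1) by (auto simp: Linf_space_def)
  moreover have "((\<lambda>i. Linf_norm M (\<lambda>\<omega>. F i \<omega> - f \<omega>)) \<longlongrightarrow> 0) G"
  proof (rule tendsto_sandwich)
    show "eventually (\<lambda>i. 0 \<le> Linf_norm M (\<lambda>\<omega>. F i \<omega> - f \<omega>)) G"
      using Linf_norm_nonneg[OF assms(1)] by auto
    show "eventually (\<lambda>i. Linf_norm M (\<lambda>\<omega>. F i \<omega> - f \<omega>) \<le> ereal (e i)) G"
      using le by eventually_elim (auto intro!: Linf_norm_le borel_measurable_diff f)
    show "((\<lambda>i. ereal (e i)) \<longlongrightarrow> 0) G"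
      using e by (simp add: zero_ereal_def)
  qed simp
  ultimately show ?thesis by (simp add: Linf_tendsto_def)
qed

lemma Linf_tendsto_AE_unique:
  assumes "Linf_tendsto M F f G" "Linf_tendsto M F g G" "G \<noteq> bot"
  shows "AE \<omega> in M. f \<omega> = g \<omega>"
proof -
  \<comment> \<open>The tolerances run through a sequence, so that the almost sure bounds hold simultaneously.\<close>
  have "AE \<omega> in M. \<bar>f \<omega> - g \<omega>\<bar> \<le> 2 * (1 / real (Suc k))" for k
  proof -
    have "eventually (\<lambda>i. (AE \<omega> in M. \<bar>F i \<omega> - f \<omega>\<bar> \<le> 1 / real (Suc k)) \<and>
            (AE \<omega> in M. \<bar>F i \<omega> - g \<omega>\<bar> \<le> 1 / real (Suc k))) G"
      using assms by (intro eventually_conj Linf_tendsto_eventually_AE) auto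
    then obtain i where "AE \<omega> in M. \<bar>F i \<omega> - f \<omega>\<bar> \<le> 1 / real (Suc k)"
        "AE \<omega> in M. \<bar>F i \<omega> - g \<omega>\<bar> \<le> 1 / real (Suc k)"
      using assms(3) eventually_happens' by blast
    then show ?thesis by eventually_elim linarith
  qed
  then have "AE \<omega> in M. \<forall>k. \<bar>f \<omega> - g \<omega>\<bar> \<le> 2 * (1 / real (Suc k))"
    by (simp add: AE_all_countable)
  then show ?thesis
  proof eventually_elim
    case (elim \<omega>)
    have "(\<lambda>k. 2 * (1 / real (Suc k))) \<longlonglongrightarrow> 2 * 0"
      by (intro tendsto_mult tendsto_const LIMSEQ_Suc[OF lim_1_over_n])
    with elim have "\<bar>f \<omega> - g \<omega>\<bar> \<le> 2 * 0"
      by (intro LIMSEQ_le_const) auto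
    then show ?case by simp
  qed
qed

section \<open>Majorants of the solution coefficients\<close>

lemma sol_coeff_measurable:
  assumes [measurable]: "\<And>n. A n \<in> borel_measurable M" "\<And>n. B n \<in> borel_measurable M"
  shows "sol_coeff A B c0 c1 n \<in> borel_measurable M"
proof (induction n rule: less_induct)
  case (less n)
  consider "n = 0" | "n = 1" | k where "n = Suc (Suc k)"
    by (metis One_nat_def not0_implies_Suc)
  then show ?case
  proof cases
    case (3 k)
    have "(\<lambda>\<omega>. sol_coeff A B c0 c1 n \<omega>) \<in> borel_measurable M"
      unfolding 3 sol_coeff.simps
      by (intro borel_measurable_times borel_measurable_sum borel_measurable_add borel_measurable_const assms less)
        (auto simp: 3)
    then show ?thesis by simp
  qed (simp_all add: fun_eq_iff measurable_cong[of M "sol_coeff A B c0 c1 _" "\<lambda>_. _"])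
qed

text \<open>
  The solution coefficients, and hence \<open>S0(t)\<close> and \<open>S1(t)\<close>, depend on \<open>\<omega>\<close> only through the two
  coefficient sequences.  This is the form in which independence of \<open>Y1\<close> from \<open>(A, B)\<close> applies.
\<close>

lemma sol_coeff_sequences:
  "sol_coeff A B c0 c1 n \<omega> =
     sol_coeff (\<lambda>n p. fst p n) (\<lambda>n p. snd p n) c0 c1 n ((\<lambda>n. A n \<omega>), (\<lambda>n. B n \<omega>))"
proof (induction n rule: less_induct)
  case (less n)
  consider "n = 0" | "n = 1" | k where "n = Suc (Suc k)"
    by (metis One_nat_def not0_implies_Suc)
  then show ?case
  proof cases
    case (3 k)
    then show ?thesis
      using less by (auto intro!: sum.cong)
  qed auto
qed

lemma sol_coeff_neg_Suc_Suc:
  "sol_coeff (\<lambda>n _. - a n) (\<lambda>n _. - b n) c0 c1 (Suc (Suc n)) \<omega> =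
     1 / ((real n + 2) * (real n + 1)) *
     (\<Sum>m\<in>{0..n}. (real m + 1) * a (n - m) * sol_coeff (\<lambda>n _. - a n) (\<lambda>n _. - b n) c0 c1 (Suc m) \<omega>
                 + b (n - m) * sol_coeff (\<lambda>n _. - a n) (\<lambda>n _. - b n) c0 c1 m \<omega>)"
  (is "?l = ?c * (\<Sum>m\<in>_. ?g m)")
proof -
  have "?l = - 1 / ((real n + 2) * (real n + 1)) * (\<Sum>m\<in>{0..n}. - ?g m)"
    unfolding sol_coeff.simps by (intro arg_cong[where f = "(*) _"] sum.cong) auto
  then show ?thesis unfolding sum_negf by simp
qed

text \<open>
  Negating the coefficients of the equation cancels the minus sign of the recurrence, which then has only
  nonnegative terms and dominates by the triangle inequality.
\<close>

lemma sol_coeff_abs_le: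
  assumes "\<And>n. \<bar>A n \<omega>\<bar> \<le> a n" "\<And>n. \<bar>B n \<omega>\<bar> \<le> b n"
  shows "\<bar>sol_coeff A B c0 c1 n \<omega>\<bar> \<le> sol_coeff (\<lambda>n _. - a n) (\<lambda>n _. - b n) \<bar>c0\<bar> \<bar>c1\<bar> n \<omega>'"
proof (induction n rule: less_induct)
  case (less n)
  let ?S = "\<lambda>n. sol_coeff A B c0 c1 n \<omega>"
  let ?s = "\<lambda>n. sol_coeff (\<lambda>n _. - a n) (\<lambda>n _. - b n) \<bar>c0\<bar> \<bar>c1\<bar> n \<omega>'"
  consider "n = 0" | "n = 1" | k where "n = Suc (Suc k)"
    by (metis One_nat_def not0_implies_Suc)
  then show ?case
  proof cases
    case (3 k)
    have "\<bar>\<Sum>m\<in>{0..k}. (real m + 1) * A (k - m) \<omega> * ?S (Suc m) + B (k - m) \<omega> * ?S m\<bar>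
        \<le> (\<Sum>m\<in>{0..k}. (real m + 1) * a (k - m) * ?s (Suc m) + b (k - m) * ?s m)"
    proof (rule order_trans[OF sum_abs sum_mono])
      fix m assume m: "m \<in> {0..k}"
      have "0 \<le> a (k - m)" "0 \<le> b (k - m)"
        using assms[of "k - m"] by linarith+
      then have "\<bar>(real m + 1) * A (k - m) \<omega> * ?S (Suc m)\<bar> \<le> (real m + 1) * a (k - m) * ?s (Suc m)"
        and "\<bar>B (k - m) \<omega> * ?S m\<bar> \<le> b (k - m) * ?s m"
        using less[of m] less[of "Suc m"] assms[of "k - m"] m 3
        unfolding abs_mult by (auto intro!: mult_mono)
      then show "\<bar>(real m + 1) * A (k - m) \<omega> * ?S (Suc m) + B (k - m) \<omega> * ?S m\<bar>
          \<le> (real m + 1) * a (k - m) * ?s (Suc m) + b (k - m) * ?s m"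
        by linarith
    qed
    then have "1 / ((real k + 2) * (real k + 1)) *
          \<bar>\<Sum>m\<in>{0..k}. (real m + 1) * A (k - m) \<omega> * ?S (Suc m) + B (k - m) \<omega> * ?S m\<bar>
        \<le> 1 / ((real k + 2) * (real k + 1)) *
          (\<Sum>m\<in>{0..k}. (real m + 1) * a (k - m) * ?s (Suc m) + b (k - m) * ?s m)"
      by (intro mult_left_mono) auto
    also have "\<dots> = ?s n"
      unfolding 3 sol_coeff_neg_Suc_Suc by simp
    finally show ?thesis
      by (simp add: 3 abs_mult)
  qed auto
qed

text \<open>
  The convolution with a geometric sequence satisfies \<open>T (n + 1) = T n / \<rho> + C w (n + 1)\<close>, which
  collapses the recurrence over all earlier coefficients to one over the last two.
\<close>

lemma sol_coeff_geometric_rec: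
  fixes C \<rho> p q :: real
  defines "s \<equiv> \<lambda>n. sol_coeff (\<lambda>n _. - (C / \<rho> ^ n)) (\<lambda>n _. - (C / \<rho> ^ n)) p q n ()"
  shows "(real n + 3) * (real n + 2) * s (n + 3) =
           (real n + 2) * (real n + 1) * s (n + 2) / \<rho> + C * ((real n + 2) * s (n + 2) + s (n + 1))"
proof -
  define w where "w m = (real m + 1) * s (Suc m) + s m" for m
  define T where "T n = (\<Sum>m\<in>{0..n}. C / \<rho> ^ (n - m) * w m)" for n
  have s2: "(real n + 2) * (real n + 1) * s (Suc (Suc n)) = T n" for n
  proof -
    have "s (Suc (Suc n)) = 1 / ((real n + 2) * (real n + 1)) * T n"
      unfolding s_def T_def w_def sol_coeff_neg_Suc_Suc by (simp add: algebra_simps add_divide_distrib)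
    then show ?thesis by simp
  qed
  have "T (Suc n) = T n / \<rho> + C * w (Suc n)"
  proof -
    have "(\<Sum>m\<in>{0..n}. C / \<rho> ^ (Suc n - m) * w m) = T n / \<rho>"
      unfolding T_def sum_divide_distrib
      by (rule sum.cong) (auto simp: Suc_diff_le)
    then show ?thesis by (simp add: T_def)
  qed
  then show ?thesis
    using s2[of "Suc n"] unfolding s2[of n, symmetric] w_def
    by (simp add: algebra_simps numeral_3_eq_3)
qed

text \<open>
  For \<open>\<sigma> < \<tau> < \<rho>\<close> the scaled coefficients \<open>v n = s n * \<tau> ^ n\<close> satisfy
  \<open>v (n + 3) \<le> \<theta> (n + 3) * max (v (n + 2)) (v (n + 1))\<close> with \<open>\<theta> n\<close> tending to \<open>\<tau> / \<rho> < 1\<close>.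
  So \<open>v\<close> is bounded, and Abel's lemma gives convergence at the smaller radius \<open>\<sigma>\<close>.
\<close>

lemma sol_coeff_geometric_summable:
  fixes C \<rho> p q \<sigma> :: real
  defines "s \<equiv> \<lambda>n. sol_coeff (\<lambda>n _. - (C / \<rho> ^ n)) (\<lambda>n _. - (C / \<rho> ^ n)) \<bar>p\<bar> \<bar>q\<bar> n ()"
  assumes "0 < \<sigma>" "\<sigma> < \<rho>" "0 \<le> C"
  shows "summable (\<lambda>n. s n * \<sigma> ^ n)"
proof -
  have s_nonneg: "0 \<le> s n" for n
  proof -
    have "\<bar>sol_coeff (\<lambda>n _. C / \<rho> ^ n) (\<lambda>n _. C / \<rho> ^ n) p q n ()\<bar> \<le> s n"
      unfolding s_def using assms by (intro sol_coeff_abs_le) auto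
    then show ?thesis by linarith
  qed
  \<comment> \<open>An intermediate radius: \<open>s n * \<tau> ^ n\<close> is merely bounded, which suffices for summability at \<open>\<sigma>\<close>.\<close>
  obtain \<tau> where \<tau>: "\<sigma> < \<tau>" "\<tau> < \<rho>"
    using assms(3) dense by blast
  then have "0 < \<tau>" "0 < \<rho>" using assms by auto
  define v where "v n = s n * \<tau> ^ n" for n
  have v_nonneg: "0 \<le> v n" for n
    using s_nonneg \<open>0 < \<tau>\<close> by (simp add: v_def)
  define \<theta> where "\<theta> n = \<tau> / \<rho> + (C * \<tau> + C * \<tau>\<^sup>2) * (1 / real n)" for n
  have step: "v (n + 3) \<le> \<theta> (n + 3) * max (v (n + 2)) (v (n + 1))" for n
  proof -
    let ?m = "max (v (n + 2)) (v (n + 1))"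
    let ?a = "(real n + 1) / (real n + 3) * (\<tau> / \<rho>) + C * \<tau> / (real n + 3)"
    let ?b = "C * \<tau>\<^sup>2 / ((real n + 3) * (real n + 2))"
    have "(real n + 3) * (real n + 2) * s (n + 3) = (real n + 2) * (real n + 1) * s (n + 2) / \<rho>
        + C * ((real n + 2) * s (n + 2) + s (n + 1))"
      unfolding s_def by (rule sol_coeff_geometric_rec)
    then have "((real n + 3) * (real n + 2)) * v (n + 3) =
        ((real n + 2) * (real n + 1) * s (n + 2) / \<rho> + C * ((real n + 2) * s (n + 2) + s (n + 1))) * \<tau> ^ (n + 3)"
      by (simp add: v_def)
    also have "\<dots> = ((real n + 3) * (real n + 2)) * (?a * v (n + 2) + ?b * v (n + 1))"
    proof -
      have "(real n + 3) * (real n + 2) * ?a = (real n + 2) * ((real n + 1) * \<tau> / \<rho> + C * \<tau>)"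
        and "(real n + 3) * (real n + 2) * ?b = C * \<tau>\<^sup>2"
        using \<open>0 < \<rho>\<close> by (simp_all add: divide_simps)
      then show ?thesis
        unfolding distrib_left mult.assoc[symmetric]
        by (simp add: v_def power_add power2_eq_square power3_eq_cube algebra_simps)
    qed
    finally have "v (n + 3) = ?a * v (n + 2) + ?b * v (n + 1)"
      by (subst (asm) mult_cancel_left) simp
    also have "?a * v (n + 2) + ?b * v (n + 1) \<le> ?a * ?m + ?b * ?m"
      using \<open>0 < \<tau>\<close> \<open>0 < \<rho>\<close> \<open>0 \<le> C\<close> by (intro add_mono mult_left_mono) auto
    also have "\<dots> = (?a + ?b) * ?m" by (simp add: algebra_simps)
    also have "\<dots> \<le> \<theta> (n + 3) * ?m"
    proof (rule mult_right_mono)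
      have "(real n + 1) / (real n + 3) * (\<tau> / \<rho>) \<le> 1 * (\<tau> / \<rho>)"
        using \<open>0 < \<tau>\<close> \<open>0 < \<rho>\<close> by (intro mult_right_mono) auto
      moreover have "?b \<le> C * \<tau>\<^sup>2 / (real n + 3)"
      proof (rule divide_left_mono)
        have "(real n + 3) * 1 \<le> (real n + 3) * (real n + 2)" by (intro mult_left_mono) auto
        then show "real n + 3 \<le> (real n + 3) * (real n + 2)" by simp
      qed (use \<open>0 \<le> C\<close> in auto)
      moreover have "\<theta> (n + 3) = \<tau> / \<rho> + C * \<tau> / (real n + 3) + C * \<tau>\<^sup>2 / (real n + 3)"
        by (simp add: \<theta>_def add_divide_distrib)
      ultimately show "?a + ?b \<le> \<theta> (n + 3)"
        by linarith
    qed (use v_nonneg in \<open>simp add: max_def\<close>)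
    finally show ?thesis .
  qed
  have "\<theta> \<longlonglongrightarrow> \<tau> / \<rho> + (C * \<tau> + C * \<tau>\<^sup>2) * 0"
    unfolding \<theta>_def by (intro tendsto_intros lim_1_over_n)
  then have "eventually (\<lambda>n. \<theta> n < 1) sequentially"
    using \<tau> \<open>0 < \<rho>\<close> by (intro order_tendstoD(2)[where a = 1]) auto
  then obtain N where N: "\<And>n. n \<ge> N \<Longrightarrow> \<theta> n < 1"
    by (auto simp: eventually_sequentially)
  define K where "K = (\<Sum>n<N + 3. v n)"
  have "v n \<le> K" for n
  proof (induction n rule: less_induct)
    case (less n)
    show ?case
    proof (cases "n < N + 3")
      case True
      then show ?thesis
        unfolding K_def by (intro member_le_sum) (auto simp: v_nonneg)
    next
      case False
      define k where "k = n - 3"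
      have k: "n = k + 3" using False by (simp add: k_def)
      have "v n \<le> \<theta> (k + 3) * max (v (k + 2)) (v (k + 1))"
        using step k by simp
      also have "\<dots> \<le> 1 * max (v (k + 2)) (v (k + 1))"
        using N[of "k + 3"] False k v_nonneg by (intro mult_right_mono) (auto simp: max_def)
      also have "\<dots> \<le> K"
        using less[of "k + 2"] less[of "k + 1"] k by auto
      finally show ?thesis .
    qed
  qed
  then have "norm (s n) * \<tau> ^ n \<le> K" for n
    using s_nonneg by (simp add: v_def)
  then have "summable (\<lambda>n. norm (s n) * \<sigma> ^ n)"
    using \<tau> assms by (intro Abel_lemma) auto
  then show "summable (\<lambda>n. s n * \<sigma> ^ n)"
    using s_nonneg by simp
qed

text \<open>
  Successive partial sums at \<open>t0 + \<rho>\<close> differ by \<open>C n * \<rho> ^ n\<close> and are eventually within \<open>1\<close> of the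
  limit, so this term is almost surely at most \<open>2\<close>; each of the finitely many earlier coefficients is
  essentially bounded by itself.
\<close>

lemma random_power_series_coeff_bound:
  assumes "random_power_series_on M t0 r C" "0 < \<rho>" "\<rho> < r"
  obtains K where "0 \<le> K" "AE \<omega> in M. \<forall>n. \<bar>C n \<omega>\<bar> \<le> K / \<rho> ^ n"
proof -
  let ?t = "t0 + \<rho>"
  have C: "C n \<in> Linf_space M" for n
    using assms by (simp add: random_power_series_on_def)
  obtain f where "Linf_tendsto M (\<lambda>N. partial_sum t0 C N ?t) f sequentially"
    using assms unfolding random_power_series_on_def by force
  from Linf_tendsto_eventually_AE[OF this, of 1]
  obtain N where N: "\<And>n. n \<ge> N \<Longrightarrow> AE \<omega> in M. \<bar>partial_sum t0 C n ?t \<omega> - f \<omega>\<bar> \<le> 1"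
    by (auto simp: eventually_sequentially)
  have "\<exists>c. AE \<omega> in M. \<bar>C n \<omega>\<bar> \<le> c" for n
    using Linf_space_AE_bound[OF C] by blast
  then obtain c where c: "\<And>n. AE \<omega> in M. \<bar>C n \<omega>\<bar> \<le> c n" by metis
  define K where "K = 2 + (\<Sum>n\<le>N. \<bar>c n\<bar> * \<rho> ^ n)"
  have sum_nonneg: "0 \<le> (\<Sum>n\<le>N. \<bar>c n\<bar> * \<rho> ^ n)"
    using assms by (intro sum_nonneg) auto
  have "AE \<omega> in M. \<bar>C n \<omega>\<bar> \<le> K / \<rho> ^ n" for n
  proof (cases "n \<le> N")
    case True
    show ?thesis using c[of n]
    proof eventually_elim
      case (elim \<omega>)
      have "\<bar>C n \<omega>\<bar> * \<rho> ^ n \<le> \<bar>c n\<bar> * \<rho> ^ n"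
        using elim assms by (intro mult_right_mono) auto
      also have "\<dots> \<le> (\<Sum>n\<le>N. \<bar>c n\<bar> * \<rho> ^ n)"
        using True assms by (intro member_le_sum) auto
      finally show ?case
        using assms by (simp add: K_def field_simps)
    qed
  next
    case False
    then obtain m where m: "n = Suc m" "m \<ge> N"
      by (cases n) auto
    then have "N \<le> n" by simp
    show ?thesis
      using N[OF m(2)] N[OF \<open>N \<le> n\<close>]
    proof eventually_elim
      case (elim \<omega>)
      have "partial_sum t0 C n ?t \<omega> - partial_sum t0 C m ?t \<omega> = C n \<omega> * \<rho> ^ n"
        by (simp add: partial_sum_def m)
      then have "\<bar>C n \<omega>\<bar> * \<rho> ^ n \<le> 2"
        using elim assms by (simp add: abs_mult[symmetric] flip: abs_power_minus)
      then show ?case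
        using assms sum_nonneg by (simp add: K_def field_simps)
    qed
  qed
  then have "AE \<omega> in M. \<forall>n. \<bar>C n \<omega>\<bar> \<le> K / \<rho> ^ n"
    by (simp add: AE_all_countable)
  moreover have "0 \<le> K" using sum_nonneg by (simp add: K_def)
  ultimately show ?thesis using that by blast
qed

lemma sol_coeff_dominated:
  assumes "random_power_series_on M t0 r A" "random_power_series_on M t0 r B" "0 < \<sigma>" "\<sigma> < r"
  obtains s where "summable (\<lambda>n. s n * \<sigma> ^ n)"
    "AE \<omega> in M. \<forall>n. \<bar>sol_coeff A B c0 c1 n \<omega>\<bar> \<le> s n"
proof -
  obtain \<rho> where \<rho>: "\<sigma> < \<rho>" "\<rho> < r" using assms(4) dense by blast
  with assms have "0 < \<rho>" by auto
  obtain K where K: "0 \<le> K" "AE \<omega> in M. \<forall>n. \<bar>A n \<omega>\<bar> \<le> K / \<rho> ^ n"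
    using random_power_series_coeff_bound[OF assms(1) \<open>0 < \<rho>\<close> \<rho>(2)] .
  obtain L where L: "0 \<le> L" "AE \<omega> in M. \<forall>n. \<bar>B n \<omega>\<bar> \<le> L / \<rho> ^ n"
    using random_power_series_coeff_bound[OF assms(2) \<open>0 < \<rho>\<close> \<rho>(2)] .
  let ?C = "max K L"
  let ?s = "\<lambda>n. sol_coeff (\<lambda>n _. - (?C / \<rho> ^ n)) (\<lambda>n _. - (?C / \<rho> ^ n)) \<bar>c0\<bar> \<bar>c1\<bar> n ()"
  have "0 \<le> ?C" using K by auto
  have "AE \<omega> in M. \<forall>n. \<bar>sol_coeff A B c0 c1 n \<omega>\<bar> \<le> ?s n"
    using K(2) L(2)
  proof eventually_elim
    case (elim \<omega>)
    have "K / \<rho> ^ n \<le> ?C / \<rho> ^ n" "L / \<rho> ^ n \<le> ?C / \<rho> ^ n" for n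
      using \<open>0 < \<rho>\<close> by (auto intro!: divide_right_mono)
    with elim show ?case
      by (intro allI sol_coeff_abs_le) (meson order_trans)+
  qed
  then show ?thesis
    using that[of ?s] sol_coeff_geometric_summable[OF assms(3) \<rho>(1) \<open>0 \<le> ?C\<close>] by blast
qed

section \<open>Real power series with majorised coefficients\<close>

lemma powser_tail_le:
  fixes c s :: "nat \<Rightarrow> real"
  assumes c: "\<And>n. \<bar>c n\<bar> \<le> s n" and s: "summable (\<lambda>n. s n * \<sigma> ^ n)" and z: "\<bar>z\<bar> \<le> \<sigma>"
  shows "summable (\<lambda>n. c n * z ^ n)"
    and "\<bar>(\<Sum>n\<le>N. c n * z ^ n) - (\<Sum>n. c n * z ^ n)\<bar> \<le> (\<Sum>n. s n * \<sigma> ^ n) - (\<Sum>n\<le>N. s n * \<sigma> ^ n)"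
proof -
  have le: "norm (c n * z ^ n) \<le> s n * \<sigma> ^ n" for n
    unfolding real_norm_def abs_mult power_abs
    using c[of n] z by (intro mult_mono power_mono) auto
  show sm: "summable (\<lambda>n. c n * z ^ n)"
    using le by (intro summable_comparison_test'[OF s]) auto
  have "norm (\<Sum>n. c (n + Suc N) * z ^ (n + Suc N)) \<le> (\<Sum>n. s (n + Suc N) * \<sigma> ^ (n + Suc N))"
    using summable_ignore_initial_segment[OF s, of "Suc N"] le by (intro norm_suminf_le)
  then show "\<bar>(\<Sum>n\<le>N. c n * z ^ n) - (\<Sum>n. c n * z ^ n)\<bar> \<le> (\<Sum>n. s n * \<sigma> ^ n) - (\<Sum>n\<le>N. s n * \<sigma> ^ n)"
    using suminf_minus_initial_segment[OF sm, of "Suc N"] suminf_minus_initial_segment[OF s, of "Suc N"]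
    by (simp add: lessThan_Suc_atMost abs_minus_commute del: power_Suc)
qed

text \<open>
  The error of the difference quotient is linear in \<open>h\<close> with a constant that depends on the coefficients
  only through their majorant.  This uniformity turns differentiability of each path into
  differentiability in \<open>L\<^sup>\<infinity>(\<Omega>)\<close>.
\<close>

lemma powser_difference_quotient_le:
  fixes c s :: "nat \<Rightarrow> real"
  assumes c: "\<And>n. \<bar>c n\<bar> \<le> s n" and s: "summable (\<lambda>n. s n * \<sigma> ^ n)"
    and K: "\<bar>z\<bar> \<le> K" "\<bar>z + h\<bar> \<le> K" "K < \<sigma>" and h: "h \<noteq> 0"
  shows "\<bar>((\<Sum>n. c n * (z + h) ^ n) - (\<Sum>n. c n * z ^ n)) / h - (\<Sum>n. diffs c n * z ^ n)\<bar>
           \<le> (\<Sum>n. s n * (real n * real (n - 1) * K ^ (n - 2))) * \<bar>h\<bar>"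
proof -
  have s_nonneg: "0 \<le> s n" for n using c[of n] by linarith
  have sm: "summable (\<lambda>n. a n * x ^ n)" if "\<And>n. \<bar>a n\<bar> \<le> s n" "\<bar>x\<bar> \<le> \<sigma>" for a :: "nat \<Rightarrow> real" and x
    using powser_tail_le(1)[OF that(1) s that(2)] .
  have smd: "summable (\<lambda>n. diffs a n * x ^ n)" if "\<And>n. \<bar>a n\<bar> \<le> s n" "\<bar>x\<bar> < \<sigma>" for a :: "nat \<Rightarrow> real" and x
    using that by (intro termdiff_converges[where K = \<sigma>] sm) auto
  \<comment> \<open>The constant is the second derivative of the majorant series at \<open>K\<close>.\<close>
  have "summable (\<lambda>n. diffs (diffs s) n * K ^ n)"
    using K s_nonneg by (intro termdiff_converges[where K = \<sigma>] smd) auto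
  also have "(\<lambda>n. diffs (diffs s) n * K ^ n) =
      (\<lambda>n. s (n + 2) * (real (n + 2) * real (n + 2 - 1) * K ^ (n + 2 - 2)))"
    by (auto simp: diffs_def fun_eq_iff)
  finally have sm2: "summable (\<lambda>n. s n * (real n * real (n - 1) * K ^ (n - 2)))"
    by (rule summable_iff_shift[THEN iffD1])
  have "(\<lambda>n. c n * (z + h) ^ n) sums (\<Sum>n. c n * (z + h) ^ n)"
    "(\<lambda>n. c n * z ^ n) sums (\<Sum>n. c n * z ^ n)"
    using K c by (auto intro!: summable_sums sm)
  moreover have "(\<lambda>n. real n * c n * z ^ (n - Suc 0)) sums (\<Sum>n. diffs c n * z ^ n)"
    using K c by (intro diffs_equiv smd) auto
  ultimately have "(\<lambda>n. (c n * (z + h) ^ n - c n * z ^ n) / h - real n * c n * z ^ (n - Suc 0)) sums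
      (((\<Sum>n. c n * (z + h) ^ n) - (\<Sum>n. c n * z ^ n)) / h - (\<Sum>n. diffs c n * z ^ n))"
    by (intro sums_diff sums_divide)
  also have "(\<lambda>n. (c n * (z + h) ^ n - c n * z ^ n) / h - real n * c n * z ^ (n - Suc 0)) =
      (\<lambda>n. c n * (((z + h) ^ n - z ^ n) / h - real n * z ^ (n - Suc 0)))"
    by (auto simp: fun_eq_iff algebra_simps diff_divide_distrib)
  finally have sums: "(\<lambda>n. c n * (((z + h) ^ n - z ^ n) / h - real n * z ^ (n - Suc 0))) sums
      (((\<Sum>n. c n * (z + h) ^ n) - (\<Sum>n. c n * z ^ n)) / h - (\<Sum>n. diffs c n * z ^ n))" .
  have "norm (\<Sum>n. c n * (((z + h) ^ n - z ^ n) / h - real n * z ^ (n - Suc 0)))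
      \<le> (\<Sum>n. s n * (real n * real (n - 1) * K ^ (n - 2)) * \<bar>h\<bar>)"
  proof (rule norm_suminf_le)
    fix n
    have "\<bar>((z + h) ^ n - z ^ n) / h - real n * z ^ (n - Suc 0)\<bar>
        \<le> real n * real (n - Suc 0) * K ^ (n - 2) * \<bar>h\<bar>"
      using lemma_termdiff3[of h z K n] K h by simp
    then have "\<bar>c n\<bar> * \<bar>((z + h) ^ n - z ^ n) / h - real n * z ^ (n - Suc 0)\<bar>
        \<le> s n * (real n * real (n - Suc 0) * K ^ (n - 2) * \<bar>h\<bar>)"
      using c s_nonneg by (intro mult_mono) auto
    then show "norm (c n * (((z + h) ^ n - z ^ n) / h - real n * z ^ (n - Suc 0)))
        \<le> s n * (real n * real (n - 1) * K ^ (n - 2)) * \<bar>h\<bar>"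
      by (simp add: abs_mult mult_ac)
  qed (intro summable_mult2 sm2)
  then show ?thesis
    using sums_unique[OF sums] suminf_mult2[OF sm2, of "\<bar>h\<bar>"] by simp
qed

text \<open>
  By the mean value theorem the sum is \<open>z\<close> times its derivative at an intermediate point.  The lower bound
  on the derivative is assumed at rational points only, since an almost sure statement can be
  made simultaneous over countably many points; continuity of the derivative does the rest.
\<close>

lemma powser_abs_ge:
  fixes c :: "nat \<Rightarrow> real"
  assumes sm: "\<And>x. \<bar>x\<bar> \<le> \<sigma> \<Longrightarrow> summable (\<lambda>n. c n * x ^ n)" and "c 0 = 0" and z: "\<bar>z\<bar> < \<sigma>"
    and deriv: "\<And>q. q \<in> \<rat> \<Longrightarrow> \<bar>q\<bar> < \<bar>z\<bar> \<Longrightarrow> \<kappa> < (\<Sum>n. diffs c n * q ^ n)"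
  shows "\<kappa> * \<bar>z\<bar> \<le> \<bar>\<Sum>n. c n * z ^ n\<bar>"
proof (cases "z = 0")
  case False
  let ?F = "\<lambda>x. \<Sum>n. c n * x ^ n" and ?F' = "\<lambda>x. \<Sum>n. diffs c n * x ^ n"
  have D: "(?F has_real_derivative ?F' x) (at x)" if "\<bar>x\<bar> \<le> \<bar>z\<bar>" for x
    using that z by (intro termdiffs_strong[where K = \<sigma>] sm) auto
  have "\<exists>\<xi>. \<bar>\<xi>\<bar> < \<bar>z\<bar> \<and> ?F z = z * ?F' \<xi>"
  proof (cases "0 < z")
    case True
    then obtain \<xi> where "0 < \<xi>" "\<xi> < z" "?F z - ?F 0 = (z - 0) * ?F' \<xi>"
      using MVT2[of 0 z ?F ?F'] D by auto
    then show ?thesis using \<open>c 0 = 0\<close> by (intro exI[of _ \<xi>]) auto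
  next
    case neg: False
    with False have "z < 0" by simp
    then obtain \<xi> where "z < \<xi>" "\<xi> < 0" "?F 0 - ?F z = (0 - z) * ?F' \<xi>"
      using MVT2[of z 0 ?F ?F'] D by auto
    then show ?thesis using \<open>c 0 = 0\<close> by (intro exI[of _ \<xi>]) auto
  qed
  then obtain \<xi> where \<xi>: "\<bar>\<xi>\<bar> < \<bar>z\<bar>" "?F z = z * ?F' \<xi>" by blast
  have "\<kappa> \<le> ?F' \<xi>"
  proof (rule ccontr)
    assume "\<not> \<kappa> \<le> ?F' \<xi>"
    then have "?F' \<xi> < \<kappa>" by simp
    have "isCont ?F' \<xi>"
      using \<xi>(1) z by (intro isCont_powser[where K = z] termdiff_converges[where K = \<sigma>] sm) auto
    then have "eventually (\<lambda>x. ?F' x < \<kappa>) (at \<xi>)"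
      using \<open>?F' \<xi> < \<kappa>\<close> unfolding isCont_def by (rule order_tendstoD(2))
    then obtain d where d: "d > 0" "\<And>x. x \<noteq> \<xi> \<Longrightarrow> dist x \<xi> < d \<Longrightarrow> ?F' x < \<kappa>"
      by (auto simp: eventually_at)
    have "max (\<xi> - d) (- \<bar>z\<bar>) < \<xi>" using \<xi>(1) \<open>d > 0\<close> by auto
    then obtain q where "q \<in> \<rat>" "max (\<xi> - d) (- \<bar>z\<bar>) < q" "q < \<xi>"
      using Rats_dense_in_real by blast
    then have "\<bar>q\<bar> < \<bar>z\<bar>" "dist q \<xi> < d" "q \<noteq> \<xi>"
      using \<xi>(1) by (auto simp: dist_real_def)
    with d(2)[of q] deriv[of q] \<open>q \<in> \<rat>\<close> show False
      by auto
  qed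
  then have "\<kappa> * \<bar>z\<bar> \<le> ?F' \<xi> * \<bar>z\<bar>" by (intro mult_right_mono) auto
  also have "\<dots> \<le> \<bar>?F z\<bar>" by (simp add: \<xi>(2) abs_mult mult.commute mult_left_mono)
  finally show ?thesis .
qed auto

section \<open>Random power series with a deterministic majorant\<close>

text \<open>
  A majorant that does not depend on \<open>\<omega>\<close> makes convergence uniform over almost all paths, so that
  convergence in \<open>L\<^sup>\<infinity>(\<Omega>)\<close> reduces to estimates for real series.
\<close>

locale dominated_power_series = prob_space M
  for M :: "'a measure" +
  fixes t0 \<sigma> :: real and C :: "nat \<Rightarrow> 'a \<Rightarrow> real" and s :: "nat \<Rightarrow> real"
  assumes coeff_measurable [measurable]: "\<And>n. C n \<in> borel_measurable M"
    and coeff_le: "AE \<omega> in M. \<forall>n. \<bar>C n \<omega>\<bar> \<le> s n"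
    and majorant_summable: "summable (\<lambda>n. s n * \<sigma> ^ n)"
begin

definition pathwise_sum :: "real \<Rightarrow> 'a \<Rightarrow> real" where
  "pathwise_sum t \<omega> = (\<Sum>n. C n \<omega> * (t - t0) ^ n)"

definition pathwise_deriv :: "real \<Rightarrow> 'a \<Rightarrow> real" where
  "pathwise_deriv t \<omega> = (\<Sum>n. diffs (\<lambda>n. C n \<omega>) n * (t - t0) ^ n)"

definition tail :: "nat \<Rightarrow> real" where
  "tail N = (\<Sum>n. s n * \<sigma> ^ n) - (\<Sum>n\<le>N. s n * \<sigma> ^ n)"

lemma pathwise_sum_measurable [measurable]: "pathwise_sum t \<in> borel_measurable M"
  unfolding pathwise_sum_def[abs_def] by measurable

lemma pathwise_deriv_measurable [measurable]: "pathwise_deriv t \<in> borel_measurable M"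
  unfolding pathwise_deriv_def[abs_def] diffs_def by measurable

lemma partial_sum_measurable [measurable]: "partial_sum t0 C N t \<in> borel_measurable M"
  unfolding partial_sum_def[abs_def] by measurable

lemma tail_tendsto: "tail \<longlonglongrightarrow> 0"
proof -
  have "(\<lambda>N. \<Sum>n\<le>N. s n * \<sigma> ^ n) \<longlonglongrightarrow> (\<Sum>n. s n * \<sigma> ^ n)"
    using majorant_summable by (rule summable_LIMSEQ')
  from tendsto_diff[OF tendsto_const[of "\<Sum>n. s n * \<sigma> ^ n"] this] show ?thesis
    unfolding tail_def[abs_def] by simp
qed

lemma partial_sum_pathwise_sum_le:
  assumes "\<bar>t - t0\<bar> \<le> \<sigma>"
  shows "AE \<omega> in M. \<forall>N. \<bar>partial_sum t0 C N t \<omega> - pathwise_sum t \<omega>\<bar> \<le> tail N"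
  using coeff_le
proof eventually_elim
  case (elim \<omega>)
  then show ?case
    unfolding partial_sum_def pathwise_sum_def tail_def
    by (intro allI powser_tail_le(2)[OF _ majorant_summable assms]) blast
qed

lemma partial_sum_le:
  assumes "\<bar>t - t0\<bar> \<le> \<sigma>"
  shows "AE \<omega> in M. \<forall>N. \<bar>partial_sum t0 C N t \<omega>\<bar> \<le> (\<Sum>n. s n * \<sigma> ^ n)"
  using coeff_le
proof (eventually_elim, intro allI)
  fix \<omega> N assume C: "\<forall>n. \<bar>C n \<omega>\<bar> \<le> s n"
  then have s: "0 \<le> s n" for n by (meson abs_ge_zero order_trans)
  have "0 \<le> \<sigma>" using assms by linarith
  have "\<bar>partial_sum t0 C N t \<omega>\<bar> \<le> (\<Sum>n\<le>N. s n * \<sigma> ^ n)"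
    unfolding partial_sum_def
  proof (rule order_trans[OF sum_abs sum_mono])
    show "\<bar>C n \<omega> * (t - t0) ^ n\<bar> \<le> s n * \<sigma> ^ n" for n
      unfolding abs_mult power_abs using C assms s by (intro mult_mono power_mono) auto
  qed
  also have "\<dots> \<le> (\<Sum>n. s n * \<sigma> ^ n)"
    using s \<open>0 \<le> \<sigma>\<close> by (intro sum_le_suminf majorant_summable) auto
  finally show "\<bar>partial_sum t0 C N t \<omega>\<bar> \<le> (\<Sum>n. s n * \<sigma> ^ n)" .
qed

lemma partial_sum_tendsto_pathwise_sum:
  assumes "\<bar>t - t0\<bar> \<le> \<sigma>"
  shows "AE \<omega> in M. (\<lambda>N. partial_sum t0 C N t \<omega>) \<longlonglongrightarrow> pathwise_sum t \<omega>"
  using partial_sum_pathwise_sum_le[OF assms]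
proof eventually_elim
  case (elim \<omega>)
  then have "(\<lambda>N. partial_sum t0 C N t \<omega> - pathwise_sum t \<omega>) \<longlonglongrightarrow> 0"
    by (intro Lim_null_comparison[OF _ tail_tendsto]) auto
  then show ?case by (rule LIM_zero_cancel)
qed

lemma pathwise_sum_le:
  assumes "\<bar>t - t0\<bar> \<le> \<sigma>"
  shows "AE \<omega> in M. \<bar>pathwise_sum t \<omega>\<bar> \<le> (\<Sum>n. s n * \<sigma> ^ n)"
  using partial_sum_le[OF assms] partial_sum_tendsto_pathwise_sum[OF assms]
proof eventually_elim
  case (elim \<omega>)
  then show ?case by (intro LIMSEQ_le_const2[OF tendsto_rabs]) auto
qed

lemma Linf_series_sum_eq_pathwise_sum:
  assumes "\<bar>t - t0\<bar> \<le> \<sigma>"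
  shows "Linf_tendsto M (\<lambda>N. partial_sum t0 C N t) (Linf_series_sum M t0 C t) sequentially"
    and "AE \<omega> in M. Linf_series_sum M t0 C t \<omega> = pathwise_sum t \<omega>"
proof -
  have lim: "Linf_tendsto M (\<lambda>N. partial_sum t0 C N t) (pathwise_sum t) sequentially"
  proof (rule Linf_tendstoI[where e = tail and c = "\<Sum>n. s n * \<sigma> ^ n"])
    show "eventually (\<lambda>N. partial_sum t0 C N t \<in> borel_measurable M \<and>
        (AE \<omega> in M. \<bar>partial_sum t0 C N t \<omega> - pathwise_sum t \<omega>\<bar> \<le> tail N)) sequentially"
      using partial_sum_pathwise_sum_le[OF assms] by (simp add: AE_all_countable)
  qed (simp_all add: prob_space_axioms pathwise_sum_le[OF assms] tail_tendsto)
  then show sum: "Linf_tendsto M (\<lambda>N. partial_sum t0 C N t) (Linf_series_sum M t0 C t) sequentially"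
    unfolding Linf_series_sum_def by (rule someI[of "\<lambda>f. Linf_tendsto M (\<lambda>N. partial_sum t0 C N t) f sequentially"])
  show "AE \<omega> in M. Linf_series_sum M t0 C t \<omega> = pathwise_sum t \<omega>"
    by (rule Linf_tendsto_AE_unique[OF sum lim]) simp
qed

text \<open>
  The termwise derivative of the path is a limit of the difference quotients in \<open>L\<^sup>\<infinity>(\<Omega>)\<close>, so a
  limit exists and the chosen representative agrees with it almost surely.
\<close>

lemma Linf_deriv_eq_pathwise_deriv:
  assumes "\<bar>t - t0\<bar> < \<sigma>"
  shows "AE \<omega> in M. Linf_deriv M (Linf_series_sum M t0 C) t \<omega> = pathwise_deriv t \<omega>"
proof -
  let ?Q = "\<lambda>h \<omega>. (Linf_series_sum M t0 C (t + h) \<omega> - Linf_series_sum M t0 C t \<omega>) / h"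
  obtain K where K: "\<bar>t - t0\<bar> < K" "K < \<sigma>" using dense[OF assms] by blast
  define L where "L = (\<Sum>n. s n * (real n * real (n - 1) * K ^ (n - 2)))"
  have meas: "Linf_series_sum M t0 C u \<in> borel_measurable M" if "\<bar>u - t0\<bar> \<le> \<sigma>" for u
    using Linf_series_sum_eq_pathwise_sum(1)[OF that] by (simp add: Linf_tendsto_def Linf_space_def)
  have near: "AE \<omega> in M. \<bar>?Q h \<omega> - pathwise_deriv t \<omega>\<bar> \<le> L * \<bar>h\<bar>"
    if h: "h \<noteq> 0" "\<bar>h\<bar> < K - \<bar>t - t0\<bar>" for h
  proof -
    have h': "\<bar>t + h - t0\<bar> \<le> K" using h by linarith
    then have "\<bar>t + h - t0\<bar> \<le> \<sigma>" "\<bar>t - t0\<bar> \<le> \<sigma>" using K by linarith+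
    from Linf_series_sum_eq_pathwise_sum(2)[OF this(1)] Linf_series_sum_eq_pathwise_sum(2)[OF this(2)] coeff_le
    show ?thesis
    proof eventually_elim
      case (elim \<omega>)
      then show ?case
        using powser_difference_quotient_le[of "\<lambda>n. C n \<omega>" s \<sigma> "t - t0" K h] h h' K majorant_summable
        by (simp add: pathwise_sum_def pathwise_deriv_def L_def algebra_simps)
    qed
  qed
  have "Linf_tendsto M ?Q (pathwise_deriv t) (at 0)"
  proof (rule Linf_tendstoI[where e = "\<lambda>h. L * \<bar>h\<bar>"])
    \<comment> \<open>Any admissible increment yields a bound on the derivative through its difference quotient.\<close>
    define h where "h = (K - \<bar>t - t0\<bar>) / 2"
    have h: "h \<noteq> 0" "\<bar>h\<bar> < K - \<bar>t - t0\<bar>" using K by (auto simp: h_def)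
    then have "\<bar>t + h - t0\<bar> \<le> \<sigma>" "\<bar>t - t0\<bar> \<le> \<sigma>" using K by linarith+
    from Linf_series_sum_eq_pathwise_sum(2)[OF this(1)] Linf_series_sum_eq_pathwise_sum(2)[OF this(2)]
      pathwise_sum_le[OF this(1)] pathwise_sum_le[OF this(2)] near[OF h]
    show "AE \<omega> in M. \<bar>pathwise_deriv t \<omega>\<bar> \<le> L * \<bar>h\<bar> + 2 * (\<Sum>n. s n * \<sigma> ^ n) / \<bar>h\<bar>"
    proof eventually_elim
      case (elim \<omega>)
      have "\<bar>?Q h \<omega>\<bar> \<le> 2 * (\<Sum>n. s n * \<sigma> ^ n) / \<bar>h\<bar>"
        using elim unfolding abs_divide by (intro divide_right_mono) auto
      with elim(5) show ?case by linarith
    qed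
    have "eventually (\<lambda>h. h \<noteq> 0 \<and> \<bar>h\<bar> < K - \<bar>t - t0\<bar>) (at 0)"
      using K(1) by (auto simp: eventually_at dist_real_def intro!: exI[of _ "K - \<bar>t - t0\<bar>"])
    then show "eventually (\<lambda>h. ?Q h \<in> borel_measurable M \<and>
        (AE \<omega> in M. \<bar>?Q h \<omega> - pathwise_deriv t \<omega>\<bar> \<le> L * \<bar>h\<bar>)) (at 0)"
    proof eventually_elim
      case (elim h)
      then have "\<bar>t + h - t0\<bar> \<le> \<sigma>" "\<bar>t - t0\<bar> \<le> \<sigma>" using K by linarith+
      then show ?case
        using near elim by (intro conjI borel_measurable_divide borel_measurable_diff meas) auto
    qed
    show "((\<lambda>h. L * \<bar>h\<bar>) \<longlongrightarrow> 0) (at 0)"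
      by (auto intro!: tendsto_eq_intros)
  qed (simp_all add: prob_space_axioms)
  then have "Linf_tendsto M ?Q (Linf_deriv M (Linf_series_sum M t0 C) t) (at 0)"
    unfolding Linf_deriv_def by (rule someI[of "\<lambda>D. Linf_tendsto M ?Q D (at 0)"])
  from Linf_tendsto_AE_unique[OF this \<open>Linf_tendsto M ?Q (pathwise_deriv t) (at 0)\<close>]
  show ?thesis by simp
qed

lemma pathwise_sum_abs_ge:
  assumes "\<bar>t - t0\<bar> < \<sigma>" and C0: "\<And>\<omega>. C 0 \<omega> = 0"
    and deriv: "\<And>u. \<bar>u - t0\<bar> < \<bar>t - t0\<bar> \<Longrightarrow> AE \<omega> in M. \<kappa> < Linf_deriv M (Linf_series_sum M t0 C) u \<omega>"
  shows "AE \<omega> in M. \<kappa> * \<bar>t - t0\<bar> \<le> \<bar>pathwise_sum t \<omega>\<bar>"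
proof -
  have "AE \<omega> in M. \<kappa> < pathwise_deriv (t0 + q) \<omega>" if "\<bar>q\<bar> < \<bar>t - t0\<bar>" for q
    using deriv[of "t0 + q"] Linf_deriv_eq_pathwise_deriv[of "t0 + q"] that assms(1)
    by (auto elim!: eventually_elim2)
  then have "AE \<omega> in M. \<forall>q\<in>\<rat>. \<bar>q\<bar> < \<bar>t - t0\<bar> \<longrightarrow> \<kappa> < pathwise_deriv (t0 + q) \<omega>"
    by (subst AE_ball_countable) (auto simp: countable_rat)
  then show ?thesis
    using coeff_le
  proof eventually_elim
    case (elim \<omega>)
    have "summable (\<lambda>n. C n \<omega> * x ^ n)" if "\<bar>x\<bar> \<le> \<sigma>" for x
      using elim(2) by (intro powser_tail_le(1)[OF _ majorant_summable that]) auto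
    with elim(1) show ?case
      unfolding pathwise_sum_def
      by (intro powser_abs_ge[where \<sigma> = \<sigma>]) (auto simp: pathwise_deriv_def C0 assms(1))
  qed
qed

end

section \<open>Independence and the null set of discontinuities\<close>

text \<open>
  Independence is the product formula on rectangles, and these determine the joint law.  The pair is taken
  with \<open>Y\<close> first so that \<open>Y\<close> becomes the outer variable in Fubini's theorem.
\<close>

lemma distr_pair_indep_rv:
  assumes "prob_space M" "indep_rv M N X N' Y"
  shows "distr M (N' \<Otimes>\<^sub>M N) (\<lambda>\<omega>. (Y \<omega>, X \<omega>)) = distr M N' Y \<Otimes>\<^sub>M distr M N X"
proof -
  interpret prob_space M by fact
  have [measurable]: "X \<in> measurable M N" "Y \<in> measurable M N'"
    and indep: "indep_set {X -` S \<inter> space M | S. S \<in> sets N} {Y -` S \<inter> space M | S. S \<in> sets N'}"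
    using assms(2) by (auto simp: indep_rv_def)
  interpret X: prob_space "distr M N X" by (rule prob_space_distr) simp
  interpret Y: prob_space "distr M N' Y" by (rule prob_space_distr) simp
  have "distr M N' Y \<Otimes>\<^sub>M distr M N X = distr M (N' \<Otimes>\<^sub>M N) (\<lambda>\<omega>. (Y \<omega>, X \<omega>))"
  proof (rule pair_measure_eqI)
    fix S T assume "S \<in> sets (distr M N' Y)" "T \<in> sets (distr M N X)"
    then have [measurable]: "S \<in> sets N'" "T \<in> sets N" by auto
    have "prob ((X -` T \<inter> space M) \<inter> (Y -` S \<inter> space M)) = prob (X -` T \<inter> space M) * prob (Y -` S \<inter> space M)"
      by (rule indep_setD[OF indep]) auto
    moreover have "(\<lambda>\<omega>. (Y \<omega>, X \<omega>)) -` (S \<times> T) \<inter> space M = (X -` T \<inter> space M) \<inter> (Y -` S \<inter> space M)"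
      by auto
    ultimately show "emeasure (distr M N' Y) S * emeasure (distr M N X) T =
        emeasure (distr M (N' \<Otimes>\<^sub>M N) (\<lambda>\<omega>. (Y \<omega>, X \<omega>))) (S \<times> T)"
      by (simp add: emeasure_distr emeasure_eq_measure ennreal_mult'[symmetric] mult.commute)
  qed (simp_all add: X.sigma_finite_measure_axioms Y.sigma_finite_measure_axioms)
  then show ?thesis by simp
qed

lemma AE_indep_rv:
  assumes "prob_space M" "indep_rv M N X N' Y"
    and Q [measurable]: "Measurable.pred (N' \<Otimes>\<^sub>M N) Q"
    and ae: "AE y in distr M N' Y. AE x in distr M N X. Q (y, x)"
  shows "AE \<omega> in M. Q (Y \<omega>, X \<omega>)"
proof -
  interpret prob_space M by fact
  have [measurable]: "X \<in> measurable M N" "Y \<in> measurable M N'"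
    using assms(2) by (auto simp: indep_rv_def)
  interpret X: prob_space "distr M N X" by (rule prob_space_distr) simp
  interpret Y: prob_space "distr M N' Y" by (rule prob_space_distr) simp
  interpret P: pair_sigma_finite "distr M N' Y" "distr M N X" ..
  have "AE p in distr M N' Y \<Otimes>\<^sub>M distr M N X. Q p"
    by (rule P.AE_pair_measure[OF _ ae]) measurable
  then have "AE p in distr M (N' \<Otimes>\<^sub>M N) (\<lambda>\<omega>. (Y \<omega>, X \<omega>)). Q p"
    by (subst distr_pair_indep_rv[OF assms(1,2)])
  then show ?thesis by (subst (asm) AE_distr_iff) auto
qed

text \<open>
  For fixed \<open>w\<close> with \<open>a w \<noteq> 0\<close> and \<open>b w \<noteq> 0\<close>, the map sending \<open>y\<close> to \<open>(x - y * b w) / a w\<close> is an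
  invertible affine map, and such maps pull null sets back to null sets.  As the law of \<open>Y\<close> has a density
  and \<open>Y\<close> is independent of \<open>W\<close>, Fubini's theorem transfers this to the random quotient.
\<close>

lemma AE_isCont_affine_quotient:
  fixes f :: "real \<Rightarrow> real"
  assumes "prob_space M" "indep_rv M borel Y N' W"
    and Y: "distributed M lborel Y g"
    and f: "{y. \<not> isCont f y} \<in> null_sets lebesgue"
    and [measurable]: "a \<in> borel_measurable N'" "b \<in> borel_measurable N'"
    and ab: "AE \<omega> in M. a (W \<omega>) \<noteq> 0 \<and> b (W \<omega>) \<noteq> 0"
  shows "AE \<omega> in M. isCont f ((x - Y \<omega> * b (W \<omega>)) / a (W \<omega>))"
proof -
  interpret prob_space M by fact
  have [measurable]: "W \<in> measurable M N'"
    using assms(2) by (auto simp: indep_rv_def)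
  have "AE y in lebesgue. isCont f y"
    using f by (intro AE_I'[OF f]) auto
  then have "AE y in lborel. isCont f y"
    by (simp add: AE_completion_iff)
  \<comment> \<open>The set of discontinuities is only Lebesgue measurable; it is enlarged to a Borel null set \<open>D\<close>
     to make the event below measurable.\<close>
  then obtain D where D: "D \<in> null_sets lborel" "{y. \<not> isCont f y} \<subseteq> D"
    by (auto simp: eventually_ae_filter)
  then have [measurable]: "D \<in> sets borel" by (auto simp: null_sets_def)
  have D_AE: "AE y in lborel. y \<notin> D"
    using D(1) by (rule AE_not_in)
  have Y_distr: "distr M borel Y = density lborel g"
    unfolding distributed_distr_eq_density[OF Y, symmetric] by (rule distr_cong) auto
  let ?Q = "\<lambda>(w, y). a w \<noteq> 0 \<and> b w \<noteq> 0 \<longrightarrow> (x - y * b w) / a w \<notin> D"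
  have "AE \<omega> in M. ?Q (W \<omega>, Y \<omega>)"
  proof (rule AE_indep_rv[OF assms(1,2)])
    show "AE w in distr M N' W. AE y in distr M borel Y. ?Q (w, y)"
    proof (rule AE_I2)
      fix w
      have "AE y in lborel. ?Q (w, y)"
      proof (cases "a w \<noteq> 0 \<and> b w \<noteq> 0")
        case True
        then have "AE y in lborel. x / a w + (- b w / a w) * y \<notin> D"
          by (intro AE_borel_affine[OF _ _ D_AE]) auto
        then show ?thesis
          by eventually_elim (simp add: diff_divide_distrib mult.commute)
      qed auto
      then have "AE y in density lborel g. ?Q (w, y)"
        using distributed_borel_measurable[OF Y] by (subst AE_density) auto
      then show "AE y in distr M borel Y. ?Q (w, y)"
        unfolding Y_distr .
    qed
  qed measurable
  with ab show ?thesis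
    by eventually_elim (use D(2) in auto)
qed

section \<open>Passage to the limit in the densities\<close>

text \<open>
  Dominated convergence: a denominator of at least \<open>c\<close> and a factor \<open>bN\<close> of modulus at most \<open>L\<close> turn the
  quadratic bound on \<open>f\<close> into a bound by a constant plus a multiple of \<open>Y\<^sup>2\<close>.
\<close>

lemma comb_density_tendsto:
  fixes f :: "real \<Rightarrow> real"
  assumes "prob_space M"
    and f_meas [measurable]: "f \<in> borel_measurable borel"
    and f: "\<And>y. 0 \<le> f y" "\<And>y. f y \<le> \<alpha> + \<beta> * y\<^sup>2" and \<beta>: "0 \<le> \<beta>"
    and Y: "Y \<in> L2_space M"
    and meas [measurable]: "a \<in> borel_measurable M" "b \<in> borel_measurable M"
      "\<And>N. aN N \<in> borel_measurable M" "\<And>N. bN N \<in> borel_measurable M"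
    and lim: "AE \<omega> in M. (\<lambda>N. aN N \<omega>) \<longlonglongrightarrow> a \<omega>" "AE \<omega> in M. (\<lambda>N. bN N \<omega>) \<longlonglongrightarrow> b \<omega>"
    and c: "0 < c" and lower: "eventually (\<lambda>N. AE \<omega> in M. c \<le> aN N \<omega>) sequentially"
    and upper: "\<And>N. AE \<omega> in M. \<bar>bN N \<omega>\<bar> \<le> L"
    and cont: "AE \<omega> in M. isCont f ((x - Y \<omega> * b \<omega>) / a \<omega>)"
  shows "(\<lambda>N. comb_density M f Y (aN N) (bN N) x) \<longlonglongrightarrow> comb_density M f Y a b x"
proof -
  interpret prob_space M by fact
  have [measurable]: "Y \<in> borel_measurable M" and Y2: "integrable M (\<lambda>\<omega>. (Y \<omega>)\<^sup>2)"
    using Y by (auto simp: L2_space_def)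
  obtain N0 where N0: "\<And>N. N \<ge> N0 \<Longrightarrow> AE \<omega> in M. c \<le> aN N \<omega>"
    using lower by (auto simp: eventually_sequentially)
  have lower_AE: "AE \<omega> in M. \<forall>N. c \<le> aN (N + N0) \<omega>"
    using N0 by (subst AE_all_countable) auto
  define w where "w \<omega> = (\<alpha> + \<beta> * (2 * (x\<^sup>2 + L\<^sup>2 * (Y \<omega>)\<^sup>2) / c\<^sup>2)) * (1 / c)" for \<omega>
  have "(\<lambda>N. comb_density M f Y (aN (N + N0)) (bN (N + N0)) x) \<longlonglongrightarrow> comb_density M f Y a b x"
    unfolding comb_density_def
  proof (rule integral_dominated_convergence[where w = w])
    show "integrable M w"
      using Y2 unfolding w_def by (intro integrable_mult_left integrable_add integrable_mult_right
        integrable_divide integrable_const) auto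
    show "AE \<omega> in M. (\<lambda>N. f ((x - Y \<omega> * bN (N + N0) \<omega>) / aN (N + N0) \<omega>) * (1 / \<bar>aN (N + N0) \<omega>\<bar>))
        \<longlonglongrightarrow> f ((x - Y \<omega> * b \<omega>) / a \<omega>) * (1 / \<bar>a \<omega>\<bar>)"
      using lim cont lower_AE
    proof eventually_elim
      case (elim \<omega>)
      have la: "(\<lambda>N. aN (N + N0) \<omega>) \<longlonglongrightarrow> a \<omega>" and lb: "(\<lambda>N. bN (N + N0) \<omega>) \<longlonglongrightarrow> b \<omega>"
        using elim by (auto intro: LIMSEQ_ignore_initial_segment)
      have "c \<le> a \<omega>"
        using la elim(4) by (intro LIMSEQ_le_const) auto
      with c have "a \<omega> \<noteq> 0" by auto
      then show ?case
        using la lb elim(3)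
        by (intro tendsto_mult isCont_tendsto_compose[where g = f] tendsto_intros) auto
    qed
    show "AE \<omega> in M. norm (f ((x - Y \<omega> * bN (N + N0) \<omega>) / aN (N + N0) \<omega>) * (1 / \<bar>aN (N + N0) \<omega>\<bar>)) \<le> w \<omega>" for N
      using lower_AE upper[of "N + N0"]
    proof eventually_elim
      case (elim \<omega>)
      let ?a = "aN (N + N0) \<omega>" and ?b = "bN (N + N0) \<omega>"
      have a: "c \<le> ?a" using elim by blast
      \<comment> \<open>From \<open>(x - u)\<^sup>2 + (x + u)\<^sup>2 = 2 * (x\<^sup>2 + u\<^sup>2)\<close> with \<open>u = Y \<omega> * ?b\<close>.\<close>
      have "(x - Y \<omega> * ?b)\<^sup>2 \<le> 2 * (x\<^sup>2 + ?b\<^sup>2 * (Y \<omega>)\<^sup>2)"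
        using sum_squares_ge_zero[of "x + Y \<omega> * ?b" 0]
        by (simp add: power2_eq_square algebra_simps)
      also have "\<dots> \<le> 2 * (x\<^sup>2 + L\<^sup>2 * (Y \<omega>)\<^sup>2)"
        using power_mono[OF elim(2), of 2] by (auto intro!: mult_right_mono)
      finally have "((x - Y \<omega> * ?b) / ?a)\<^sup>2 \<le> 2 * (x\<^sup>2 + L\<^sup>2 * (Y \<omega>)\<^sup>2) / c\<^sup>2"
        unfolding power_divide using a c by (intro frac_le power_mono) auto
      then have "f ((x - Y \<omega> * ?b) / ?a) \<le> \<alpha> + \<beta> * (2 * (x\<^sup>2 + L\<^sup>2 * (Y \<omega>)\<^sup>2) / c\<^sup>2)"
        using \<beta> by (intro order_trans[OF f(2)] add_left_mono mult_left_mono)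
      moreover have "1 / \<bar>?a\<bar> \<le> 1 / c" using a c by (intro divide_left_mono) auto
      moreover have "0 \<le> f ((x - Y \<omega> * ?b) / ?a)" by (rule f(1))
      ultimately have "f ((x - Y \<omega> * ?b) / ?a) * (1 / \<bar>?a\<bar>) \<le> w \<omega>"
        unfolding w_def using c by (intro mult_mono) auto
      then show ?case using f(1) by simp
    qed
  qed measurable
  then show ?thesis by (rule LIMSEQ_offset)
qed

lemma comb_density_cong_AE:
  assumes [measurable]: "f \<in> borel_measurable borel" "Y \<in> borel_measurable M"
    "a \<in> borel_measurable M" "b \<in> borel_measurable M" "a' \<in> borel_measurable M" "b' \<in> borel_measurable M"
    and "AE \<omega> in M. a \<omega> = a' \<omega>" "AE \<omega> in M. b \<omega> = b' \<omega>"
  shows "comb_density M f Y a b x = comb_density M f Y a' b' x"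
  unfolding comb_density_def
proof (rule integral_cong_AE)
  show "AE \<omega> in M. f ((x - Y \<omega> * b \<omega>) / a \<omega>) * (1 / \<bar>a \<omega>\<bar>) = f ((x - Y \<omega> * b' \<omega>) / a' \<omega>) * (1 / \<bar>a' \<omega>\<bar>)"
    using assms(7,8) by eventually_elim simp
qed measurable

theorem theorem3p11:
  fixes M :: "'a measure"
    and t0 r \<delta> \<mu> \<alpha> \<beta> :: real
    and A B :: "nat \<Rightarrow> 'a \<Rightarrow> real"
    and Y0 Y1 :: "'a \<Rightarrow> real"
    and fY0 :: "real \<Rightarrow> real"
  assumes "prob_space M" and "complete_measure M"
    and "r > 0"
    and "random_power_series_on M t0 r A" and "random_power_series_on M t0 r B"
    and "Y0 \<in> L2_space M" and "Y1 \<in> L2_space M"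
    and "\<And>y. fY0 y \<ge> 0" and "distributed M lborel Y0 (\<lambda>y. ennreal (fY0 y))"
    and "indep_rv M borel Y0 (borel \<Otimes>\<^sub>M (seq_borel \<Otimes>\<^sub>M seq_borel))
           (\<lambda>\<omega>. (Y1 \<omega>, (\<lambda>n. A n \<omega>), (\<lambda>n. B n \<omega>)))"
    and "{y. \<not> isCont fY0 y} \<in> null_sets lebesgue"
    and "\<alpha> \<ge> 0" and "\<beta> \<ge> 0" and "\<And>y. fY0 y \<le> \<alpha> + \<beta> * y\<^sup>2"
    and "\<exists>g. distributed M lborel Y1 g"
    and "indep_rv M borel Y1 (seq_borel \<Otimes>\<^sub>M seq_borel)
           (\<lambda>\<omega>. ((\<lambda>n. A n \<omega>), (\<lambda>n. B n \<omega>)))"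
    and "0 < \<delta>" and "\<delta> \<le> r"
    and "\<And>t. t \<in> {t0 - \<delta><..<t0 + \<delta>} \<Longrightarrow>
           Linf_norm M (\<lambda>\<omega>. Linf_series_sum M t0 (S0_coeff A B) t \<omega> - 1) < ereal (1 / 4)"
    and "0 < \<mu>" and "\<mu> \<le> r"
    and "\<And>t. t \<in> {t0 - \<mu><..<t0 + \<mu>} \<Longrightarrow>
           AE \<omega> in M. Linf_deriv M (Linf_series_sum M t0 (S1_coeff A B)) t \<omega> > 3 / 4"
  shows "\<forall>t \<in> {t0 - min \<delta> \<mu><..<t0 + min \<delta> \<mu>} - {t0}. \<forall>x.
           (\<lambda>N. density_XN M fY0 Y1 t0 A B N t x) \<longlonglongrightarrow> density_X M fY0 Y1 t0 A B t x"
proof (intro ballI allI)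
  fix t x assume "t \<in> {t0 - min \<delta> \<mu><..<t0 + min \<delta> \<mu>} - {t0}"
  then have t: "\<bar>t - t0\<bar> < \<delta>" "\<bar>t - t0\<bar> < \<mu>" "t \<noteq> t0" by auto
  with \<open>\<delta> \<le> r\<close> have "\<bar>t - t0\<bar> < r" by linarith
  then obtain \<sigma> where \<sigma>: "\<bar>t - t0\<bar> < \<sigma>" "\<sigma> < r" using dense by blast
  then have "0 < \<sigma>" "\<bar>t - t0\<bar> \<le> \<sigma>" by linarith+
  interpret prob_space M by fact
  have AB [measurable]: "A n \<in> borel_measurable M" "B n \<in> borel_measurable M" for n
    using assms(4,5) by (auto simp: random_power_series_on_def Linf_space_def)
  have series: "\<exists>s. dominated_power_series M \<sigma> (sol_coeff A B c0 c1) s" for c0 c1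
  proof -
    obtain s where "summable (\<lambda>n. s n * \<sigma> ^ n)" "AE \<omega> in M. \<forall>n. \<bar>sol_coeff A B c0 c1 n \<omega>\<bar> \<le> s n"
      using sol_coeff_dominated[OF assms(4,5) \<open>0 < \<sigma>\<close> \<sigma>(2)] .
    then show ?thesis
      by (intro exI[of _ s] dominated_power_series.intro dominated_power_series_axioms.intro
          prob_space_axioms sol_coeff_measurable AB)
  qed
  obtain s0 where "dominated_power_series M \<sigma> (S0_coeff A B) s0" using series by blast
  then interpret S0: dominated_power_series M t0 \<sigma> "S0_coeff A B" s0 .
  obtain s1 where "dominated_power_series M \<sigma> (S1_coeff A B) s1" using series by blast
  then interpret S1: dominated_power_series M t0 \<sigma> "S1_coeff A B" s1 .
  note S0_sum = S0.Linf_series_sum_eq_pathwise_sum[OF \<open>\<bar>t - t0\<bar> \<le> \<sigma>\<close>]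
    and S1_sum = S1.Linf_series_sum_eq_pathwise_sum[OF \<open>\<bar>t - t0\<bar> \<le> \<sigma>\<close>]

  have "Linf_norm M (\<lambda>\<omega>. Linf_series_sum M t0 (S0_coeff A B) t \<omega> - 1) \<le> ereal (1 / 4)"
    using t by (intro less_imp_le assms(19)) auto
  from AE_abs_le_Linf_norm[OF this] S0_sum(2)
  have S0_ge: "AE \<omega> in M. 3 / 4 \<le> S0.pathwise_sum t \<omega>"
    by eventually_elim linarith
  have S0_lower: "eventually (\<lambda>N. AE \<omega> in M. 1 / 2 \<le> partial_sum t0 (S0_coeff A B) N t \<omega>) sequentially"
  proof -
    have "eventually (\<lambda>N. S0.tail N < 1 / 4) sequentially"
      by (rule order_tendstoD(2)[OF S0.tail_tendsto]) simp
    then show ?thesis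
    proof eventually_elim
      case (elim N)
      from S0_ge S0.partial_sum_pathwise_sum_le[OF \<open>\<bar>t - t0\<bar> \<le> \<sigma>\<close>] show ?case
      proof eventually_elim
        case (elim \<omega>)
        from elim(2)[rule_format, of N] elim(1) \<open>S0.tail N < 1 / 4\<close> show ?case by linarith
      qed
    qed
  qed
  have "AE \<omega> in M. 3 / 4 * \<bar>t - t0\<bar> \<le> \<bar>S1.pathwise_sum t \<omega>\<bar>"
    using t by (intro S1.pathwise_sum_abs_ge \<sigma> assms(22)) auto
  then have S1_neq: "AE \<omega> in M. S1.pathwise_sum t \<omega> \<noteq> 0"
    by eventually_elim (use t in auto)

  let ?W = "\<lambda>\<omega>. ((\<lambda>n. A n \<omega>), (\<lambda>n. B n \<omega>))"
  \<comment> \<open>\<open>?p c0 c1\<close> is the value at \<open>t\<close> of the solution as a function of the coefficient sequences.\<close>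
  let ?p = "\<lambda>c0 c1 w. \<Sum>n. sol_coeff (\<lambda>n p. fst p n) (\<lambda>n p. snd p n) c0 c1 n w * (t - t0) ^ n"
  have "(\<lambda>w. fst w n) \<in> borel_measurable (seq_borel \<Otimes>\<^sub>M seq_borel)"
    "(\<lambda>w. snd w n) \<in> borel_measurable (seq_borel \<Otimes>\<^sub>M seq_borel)" for n
    unfolding seq_borel_def by measurable
  note [measurable] = sol_coeff_measurable[OF this]
  have p_meas: "?p c0 c1 \<in> borel_measurable (seq_borel \<Otimes>\<^sub>M seq_borel)" for c0 c1
    by measurable
  have pathwise_p: "S0.pathwise_sum t \<omega> = ?p 1 0 (?W \<omega>)" "S1.pathwise_sum t \<omega> = ?p 0 1 (?W \<omega>)" for \<omega>
    unfolding S0.pathwise_sum_def S1.pathwise_sum_def by (subst sol_coeff_sequences, rule refl)+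
  obtain g where g: "distributed M lborel Y1 g" using assms(15) by blast
  have "AE \<omega> in M. isCont fY0 ((x - Y1 \<omega> * ?p 0 1 (?W \<omega>)) / ?p 1 0 (?W \<omega>))"
  proof (rule AE_isCont_affine_quotient[OF assms(1,16) g assms(11) p_meas p_meas])
    show "AE \<omega> in M. ?p 1 0 (?W \<omega>) \<noteq> 0 \<and> ?p 0 1 (?W \<omega>) \<noteq> 0"
      using S0_ge S1_neq unfolding pathwise_p by eventually_elim auto
  qed
  then have cont: "AE \<omega> in M. isCont fY0 ((x - Y1 \<omega> * S1.pathwise_sum t \<omega>) / S0.pathwise_sum t \<omega>)"
    unfolding pathwise_p .

  \<comment> \<open>Measurability of \<open>fY0\<close> itself is recovered from that of the extended density.\<close>
  have "(\<lambda>y. ennreal (fY0 y)) \<in> borel_measurable borel"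
    using distributed_borel_measurable[OF assms(9)] by simp
  then have "(\<lambda>y. enn2real (ennreal (fY0 y))) \<in> borel_measurable borel"
    by measurable
  then have f_meas: "fY0 \<in> borel_measurable borel"
    using assms(8) by simp
  have "Y1 \<in> borel_measurable M"
    using assms(7) by (simp add: L2_space_def)
  have "density_X M fY0 Y1 t0 A B t x = comb_density M fY0 Y1 (S0.pathwise_sum t) (S1.pathwise_sum t) x"
    unfolding density_X_def using S0_sum S1_sum f_meas \<open>Y1 \<in> borel_measurable M\<close>
    by (intro comb_density_cong_AE) (auto simp: Linf_tendsto_def Linf_space_def)
  moreover have "(\<lambda>N. density_XN M fY0 Y1 t0 A B N t x) \<longlonglongrightarrow>
      comb_density M fY0 Y1 (S0.pathwise_sum t) (S1.pathwise_sum t) x"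
    unfolding density_XN_def
  proof (rule comb_density_tendsto[where c = "1 / 2", OF assms(1) f_meas assms(8,14,13,7)])
    show "AE \<omega> in M. \<bar>partial_sum t0 (S1_coeff A B) N t \<omega>\<bar> \<le> (\<Sum>n. s1 n * \<sigma> ^ n)" for N
      using S1.partial_sum_le[OF \<open>\<bar>t - t0\<bar> \<le> \<sigma>\<close>] by eventually_elim blast
  qed (fact S0_lower cont S0.partial_sum_tendsto_pathwise_sum[OF \<open>\<bar>t - t0\<bar> \<le> \<sigma>\<close>]
        S1.partial_sum_tendsto_pathwise_sum[OF \<open>\<bar>t - t0\<bar> \<le> \<sigma>\<close>] | simp)+
  ultimately show "(\<lambda>N. density_XN M fY0 Y1 t0 A B N t x) \<longlonglongrightarrow> density_X M fY0 Y1 t0 A B t x"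
    by simp
qed

end
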